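(* Let $G$ be a bounded countably infinite abelian group. Then there exist $\mathfrak{c}$ (pairwise distinct) precompact group topologies of weight $\mathfrak{c}$ on $G$ which are not Mackey.
   Context: $\mathfrak{c}$ is the cardinality of the continuum. The weight of a topology is the least cardinality of a base. $\mathbb{T}$ is the unit circle group in $\mathbb{C}$ and $\mathbb{T}_+=\{z\in\mathbb{T}:\mathrm{Re}(z)\ge 0\}$. An abelian group $G$ is bounded if there is a positive integer $m$ with $mG=\{0\}$. For a topological abelian group $(G,\tau)$, the dual group $(G,\tau)^\wedge$ is the group of all continuous homomorphisms $(G,\tau)\to\mathbb{T}$. A subset $M\subseteq G$ is quasi-convex if for every $x\in G\setminus M$ there is $\phi\in (G,\tau)^\wedge$ with $\phi(M)\subseteq\mathbb{T}_+$ and $\phi(x)\notin\mathbb{T}_+$. The topology $\tau$ is locally quasi-convex if it has a basis of neighborhoods of $0$ consisting of quasi-convex sets; locally quasi-convex group topologies are taken to be Hausdorff. Two group topologies $\tau,\nu$ on $G$ are compatible if $(G,\tau)^\wedge=(G,\nu)^\wedge$. A locally quasi-convex group topology $\tau$ on $G$ is Mackey if $\nu\le\tau$ (that is, $\nu\subseteq\tau$) for every locally quasi-convex group topology $\nu$ on $G$ compatible with $\tau$. A (Hausdorff) group topology is precompact if for every neighborhood $U$ of $0$ there is a finite $F\subseteq G$ with $F+U=G$; precompact Hausdorff group topologies on abelian groups are locally quasi-convex. *)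

theory Defs
  imports "HOL-Analysis.Analysis"
begin

text \<open>Several topologies on one abelian group are compared, so the group is a type of class
  ab_group_add and a topology on it is a value of type 'a topology with full carrier.\<close>

definition group_topology :: "'a::ab_group_add topology \<Rightarrow> bool" where
  "group_topology \<tau> \<longleftrightarrow>
     topspace \<tau> = UNIV \<and>
     continuous_map (prod_topology \<tau> \<tau>) \<tau> (\<lambda>(x, y). x + y) \<and>
     continuous_map \<tau> \<tau> (\<lambda>x. - x)"

text \<open>The multiple m x is written as an m-fold sum.\<close>

definition bounded_group :: "'a::ab_group_add itself \<Rightarrow> bool" where
  "bounded_group _ \<longleftrightarrow> (\<exists>m::nat. m > 0 \<and> (\<forall>x::'a. (\<Sum>i<m. x) = 0))"

definition circle :: "complex set" where
  "circle = sphere 0 1"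

definition circle_plus :: "complex set" where
  "circle_plus = {z \<in> circle. Re z \<ge> 0}"

definition dual_group :: "'a::ab_group_add topology \<Rightarrow> ('a \<Rightarrow> complex) set" where
  "dual_group \<tau> =
     {\<phi>. continuous_map \<tau> (top_of_set circle) \<phi> \<and> (\<forall>x y. \<phi> (x + y) = \<phi> x * \<phi> y)}"

definition quasi_convex :: "'a::ab_group_add topology \<Rightarrow> 'a set \<Rightarrow> bool" where
  "quasi_convex \<tau> M \<longleftrightarrow>
     (\<forall>x. x \<notin> M \<longrightarrow> (\<exists>\<phi>\<in>dual_group \<tau>. \<phi> ` M \<subseteq> circle_plus \<and> \<phi> x \<notin> circle_plus))"

definition locally_quasi_convex :: "'a::ab_group_add topology \<Rightarrow> bool" where
  "locally_quasi_convex \<tau> \<longleftrightarrow>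
     group_topology \<tau> \<and> Hausdorff_space \<tau> \<and> neighbourhood_base_at 0 (quasi_convex \<tau>) \<tau>"

definition compatible :: "'a::ab_group_add topology \<Rightarrow> 'a topology \<Rightarrow> bool" where
  "compatible \<tau> \<nu> \<longleftrightarrow> dual_group \<tau> = dual_group \<nu>"

definition coarser :: "'a topology \<Rightarrow> 'a topology \<Rightarrow> bool" where
  "coarser \<nu> \<tau> \<longleftrightarrow> (\<forall>U. openin \<nu> U \<longrightarrow> openin \<tau> U)"

definition mackey :: "'a::ab_group_add topology \<Rightarrow> bool" where
  "mackey \<tau> \<longleftrightarrow>
     locally_quasi_convex \<tau> \<and>
     (\<forall>\<nu>. locally_quasi_convex \<nu> \<and> compatible \<nu> \<tau> \<longrightarrow> coarser \<nu> \<tau>)"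

text \<open>Precompact topologies are Hausdorff here, hence locally quasi-convex; for them, failure of
  mackey therefore always means that some compatible locally quasi-convex topology is not coarser.\<close>

definition precompact :: "'a::ab_group_add topology \<Rightarrow> bool" where
  "precompact \<tau> \<longleftrightarrow>
     group_topology \<tau> \<and> Hausdorff_space \<tau> \<and>
     (\<forall>U V. openin \<tau> V \<and> 0 \<in> V \<and> V \<subseteq> U \<longrightarrow> (\<exists>F. finite F \<and> F + U = UNIV))"

definition base_of_topology :: "'a topology \<Rightarrow> 'a set set \<Rightarrow> bool" where
  "base_of_topology \<tau> \<B> \<longleftrightarrow>
     (\<forall>V\<in>\<B>. openin \<tau> V) \<and>
     (\<forall>U x. openin \<tau> U \<and> x \<in> U \<longrightarrow> (\<exists>V\<in>\<B>. x \<in> V \<and> V \<subseteq> U))"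

text \<open>The cardinal is given by an arbitrary set \<open>K\<close> representing it.\<close>

definition has_weight :: "'a topology \<Rightarrow> 'k set \<Rightarrow> bool" where
  "has_weight \<tau> K \<longleftrightarrow>
     (\<exists>\<B>. base_of_topology \<tau> \<B> \<and> \<B> \<approx> K) \<and>
     (\<forall>\<B>. base_of_topology \<tau> \<B> \<longrightarrow> K \<lesssim> \<B>)"

end

theory Submission
  imports Defs
begin

text \<open>Since \<open>G\<close> is bounded, characters take values in a finite group of roots of unity and separate
  points from subgroups. A topology whose neighbourhoods of 0 have a base of subgroups is therefore
  locally quasi-convex, its dual \<open>H\<close> consists of the characters trivial on some basic subgroup, and the
  topology induced by \<open>H\<close> is precompact with the same dual. If some basic subgroup has infinite index
  then the induced topology is strictly coarser, so it is not Mackey.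

  To get many such topologies, choose recursively finite subgroups \<open>F\<^sub>n\<close> increasing to \<open>G\<close>, finite
  increasing sets \<open>\<Phi>\<^sub>n\<close> of characters whose annihilators \<open>K\<^sub>n\<close> satisfy \<open>K\<^sub>n \<inter> F\<^sub>n = 0\<close>, elements
  \<open>x\<^sub>n \<in> K\<^sub>n\<close> and characters \<open>\<xi>\<^sub>n\<close> that are trivial on \<open>F\<^sub>n\<close> but not at \<open>x\<^sub>n\<close>, with
  \<open>x\<^sub>n \<in> F\<^sub>n\<^sub>+\<^sub>1\<close> and \<open>\<xi>\<^sub>n \<in> \<Phi>\<^sub>n\<^sub>+\<^sub>1\<close>. Then \<open>\<xi>\<^sub>n(x\<^sub>k) = 1\<close> iff \<open>n \<noteq> k\<close>, and every infinite product of distinct \<open>\<xi>\<^sub>n\<close>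
  is finite at each point. For infinite \<open>A \<subseteq> \<nat>\<close> use the subgroups \<open>K\<^sub>k \<inter> (\<Inter>n\<in>A. ker \<xi>\<^sub>n)\<close>. The product
  of the \<open>\<xi>\<^sub>n\<close> over \<open>n \<in> B\<close> belongs to the dual iff \<open>B - A\<close> is finite, so the dual has continuum many
  elements and determines \<open>A\<close> up to finite sets. The weight is the cardinality of the dual because a
  neighbourhood of 0 in a precompact topology is annihilated by only finitely many characters.\<close>

section \<open>Characters of bounded groups\<close>

definition nmul :: "nat \<Rightarrow> 'a::ab_group_add \<Rightarrow> 'a" where
  "nmul n x = (\<Sum>i<n. x)"

lemma nmul_0 [simp]: "nmul 0 x = 0"
  and nmul_Suc [simp]: "nmul (Suc n) x = nmul n x + x"
  by (simp_all add: nmul_def)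

lemma nmul_zero [simp]: "nmul n 0 = 0"
  by (simp add: nmul_def)

lemma nmul_add_left: "nmul (i + j) x = nmul i x + nmul j x"
  by (induction j) (auto simp: algebra_simps)

lemma nmul_mult: "nmul (i * j) x = nmul i (nmul j x)"
  by (induction i) (auto simp: nmul_add_left algebra_simps)

lemma bounded_groupE:
  assumes "bounded_group TYPE('a::ab_group_add)"
  obtains m where "m > 0" "\<And>x::'a. nmul m x = 0"
  using assms unfolding bounded_group_def nmul_def by auto

text \<open>With exponent \<open>m\<close>, negation is itself a multiple. Hence closure under
  addition yields closure under negation, both for subsets of the group and for graphs of partial
  characters.\<close>

lemma nmul_minus_one:
  fixes x :: "'a::ab_group_add"
  assumes "m > 0" "\<And>x::'a. nmul m x = 0"
  shows "nmul (m - 1) x = - x"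
proof -
  have "nmul (Suc (m - 1)) x = 0"
    using assms by simp
  then show ?thesis
    by (simp add: eq_neg_iff_add_eq_0)
qed

definition additive_subgroup :: "'a::ab_group_add set \<Rightarrow> bool" where
  "additive_subgroup U \<longleftrightarrow> 0 \<in> U \<and> (\<forall>x\<in>U. \<forall>y\<in>U. x + y \<in> U) \<and> (\<forall>x\<in>U. - x \<in> U)"

lemma additive_subgroupD:
  assumes "additive_subgroup U"
  shows "0 \<in> U" "x \<in> U \<Longrightarrow> y \<in> U \<Longrightarrow> x + y \<in> U" "x \<in> U \<Longrightarrow> - x \<in> U"
    "x \<in> U \<Longrightarrow> y \<in> U \<Longrightarrow> x - y \<in> U"
  using assms unfolding additive_subgroup_def by (auto, metis diff_conv_add_uminus)

lemma nmul_mem: "additive_subgroup U \<Longrightarrow> x \<in> U \<Longrightarrow> nmul n x \<in> U"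
  by (induction n) (auto simp: additive_subgroupD)

text \<open>Induction on \<open>F\<close>: a new generator \<open>g\<close> enlarges the finite
  subgroup \<open>E\<close> to \<open>E + M\<close>, where \<open>M\<close> consists of the
  multiples of \<open>g\<close>. These repeat with period \<open>m\<close>, so \<open>M\<close> is
  finite.\<close>

lemma finite_subset_finite_subgroup:
  fixes F :: "'a::ab_group_add set"
  assumes bdd: "bounded_group TYPE('a)" and "finite F"
  shows "\<exists>E. finite E \<and> additive_subgroup E \<and> F \<subseteq> E"
  using \<open>finite F\<close>
proof induction
  case empty
  show ?case
    by (intro exI[of _ "{0}"]) (auto simp: additive_subgroup_def)
next
  case (insert g F)
  then obtain E where E: "finite E" "additive_subgroup E" "F \<subseteq> E"
    by blast
  obtain m where m: "m > 0" "\<And>x::'a. nmul m x = 0"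
    using bounded_groupE[OF bdd] by blast
  have periodic: "nmul k g = nmul (k mod m) g" for k
  proof -
    have "nmul k g = nmul (k div m * m + k mod m) g"
      by simp
    also have "\<dots> = nmul (k mod m) g"
      unfolding nmul_add_left nmul_mult using m by simp
    finally show ?thesis .
  qed
  define M where "M = range (\<lambda>k. nmul k g)"
  have "M \<subseteq> (\<lambda>k. nmul k g) ` {..<m}"
    unfolding M_def using periodic m(1) by force
  then have "finite M"
    by (rule finite_subset) simp
  have closed: "a + b \<in> E + M" if ab: "a \<in> E + M" "b \<in> E + M" for a b
  proof -
    from ab obtain e k e' k' where "a = e + nmul k g" "b = e' + nmul k' g" "e \<in> E" "e' \<in> E"
      by (auto simp: set_plus_def M_def)
    then have "a + b = (e + e') + nmul (k + k') g" "e + e' \<in> E"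
      using additive_subgroupD[OF E(2)] by (auto simp: nmul_add_left algebra_simps)
    then show ?thesis
      by (auto simp: set_plus_def M_def)
  qed
  have zero: "0 \<in> E + M"
    using additive_subgroupD(1)[OF E(2)] unfolding set_plus_def M_def
    by (auto intro!: bexI[of _ 0] exI[of _ 0])
  have "nmul n a \<in> E + M" if "a \<in> E + M" for a n
    using that zero closed by (induction n) auto
  then have "- a \<in> E + M" if "a \<in> E + M" for a
    using that nmul_minus_one[OF m] by metis
  then have "additive_subgroup (E + M)"
    using closed zero by (auto simp: additive_subgroup_def)
  moreover have "finite (E + M)"
    using \<open>finite M\<close> E(1) by (simp add: finite_set_plus)
  moreover have "insert g F \<subseteq> E + M"
  proof -
    have "g = 0 + nmul 1 g"
      by simp
    then have "g \<in> E + M"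
      using additive_subgroupD(1)[OF E(2)] unfolding M_def set_plus_def by blast
    moreover have "x = x + nmul 0 g" for x
      by simp
    then have "F \<subseteq> E + M"
      using E(3) unfolding M_def set_plus_def by blast
    ultimately show ?thesis
      by simp
  qed
  ultimately show ?case
    by blast
qed

section \<open>Characters and their extension from subgroups\<close>

definition characters :: "('a::ab_group_add \<Rightarrow> complex) set" where
  "characters = {\<phi>. (\<forall>x. \<phi> x \<in> circle) \<and> (\<forall>x y. \<phi> (x + y) = \<phi> x * \<phi> y)}"

lemma character_add: "\<phi> \<in> characters \<Longrightarrow> \<phi> (x + y) = \<phi> x * \<phi> y"
  by (simp add: characters_def)

lemma character_norm: "\<phi> \<in> characters \<Longrightarrow> norm (\<phi> x) = 1"
  by (simp add: characters_def circle_def)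

lemma character_nonzero: "\<phi> \<in> characters \<Longrightarrow> \<phi> x \<noteq> 0"
  using character_norm[of \<phi> x] by auto

lemma character_zero: "\<phi> \<in> characters \<Longrightarrow> \<phi> 0 = 1"
  using character_add[of \<phi> 0 0] character_nonzero[of \<phi> 0] by simp

lemma character_minus:
  assumes "\<phi> \<in> characters"
  shows "\<phi> (- x) = inverse (\<phi> x)"
  using character_add[OF assms, of x "- x"] character_zero[OF assms]
  by (metis ab_group_add_class.ab_left_minus add.commute inverse_unique)

lemma character_diff: "\<phi> \<in> characters \<Longrightarrow> \<phi> (x - y) = \<phi> x / \<phi> y"
  using character_add[of \<phi> x "- y"] by (simp add: character_minus divide_inverse)

lemma character_nmul: "\<phi> \<in> characters \<Longrightarrow> \<phi> (nmul n x) = \<phi> x ^ n"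
  by (induction n) (auto simp: character_zero character_add)

lemma power_character: "\<phi> \<in> characters \<Longrightarrow> (\<lambda>x. \<phi> x ^ n) \<in> characters"
  by (auto simp: characters_def circle_def norm_power power_mult_distrib)

lemma finite_roots_of_unity:
  assumes "m > 0" shows "finite {z::complex. z ^ m = 1}"
  using card_roots_unity_eq[OF assms] assms card_ge_0_finite by metis

text \<open>The \<open>m\<close>-th roots of unity serve all characters and all points at once. This
  uniformity is what later makes function spaces of values finite.\<close>

lemma character_values_finite:
  assumes "bounded_group TYPE('a::ab_group_add)"
  shows "\<exists>R. finite R \<and> (\<forall>\<phi>\<in>characters. \<forall>x::'a. \<phi> x \<in> R)"
proof -
  obtain m where m: "m > 0" "\<And>x::'a. nmul m x = 0"
    using bounded_groupE[OF assms] by blast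
  have "\<phi> x ^ m = 1" if "\<phi> \<in> characters" for \<phi> :: "'a \<Rightarrow> complex" and x
    using character_nmul[OF that] character_zero[OF that] m(2) by metis
  then show ?thesis
    using finite_roots_of_unity[OF m(1)] by blast
qed

text \<open>The powers of a nontrivial root of unity sum to zero, although the zeroth power is 1.\<close>
lemma root_of_unity_power_Re_neg:
  fixes z :: complex
  assumes "m > 0" "z ^ m = 1" "z \<noteq> 1"
  obtains j where "Re (z ^ j) < 0"
proof -
  have "(\<Sum>j<m. z ^ j) = 0"
    using assms by (simp add: geometric_sum)
  then have "(\<Sum>j<m. Re (z ^ j)) = 0"
    by (metis Re_sum zero_complex.sel(1))
  moreover have "(\<Sum>j<m. Re (z ^ j)) > 0" if "\<And>j. Re (z ^ j) \<ge> 0"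
    by (rule sum_pos2[of _ 0]) (use assms(1) that in auto)
  ultimately show thesis
    using that by (metis less_irrefl not_le)
qed

text \<open>A character defined on a subgroup is represented by its graph. Closure under negation
  needs no axiom, since every element has finite order.\<close>

definition character_graph :: "('a::ab_group_add \<times> complex) set \<Rightarrow> bool" where
  "character_graph R \<longleftrightarrow>
     (0, 1) \<in> R \<and>
     (\<forall>a z b w. (a, z) \<in> R \<longrightarrow> (b, w) \<in> R \<longrightarrow> (a + b, z * w) \<in> R) \<and>
     (\<forall>z. (0, z) \<in> R \<longrightarrow> z = 1)"

lemma character_graphD:
  assumes "character_graph R"
  shows "(0, 1) \<in> R" "(a, z) \<in> R \<Longrightarrow> (b, w) \<in> R \<Longrightarrow> (a + b, z * w) \<in> R"
    "(0, z) \<in> R \<Longrightarrow> z = 1"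
  using assms unfolding character_graph_def by auto

lemma character_graph_nmul:
  assumes "character_graph R" "(a, z) \<in> R"
  shows "(nmul n a, z ^ n) \<in> R"
proof (induction n)
  case (Suc n)
  then show ?case
    using character_graphD(2)[OF assms(1) Suc assms(2)] by (simp add: mult.commute)
qed (simp add: character_graphD[OF assms(1)])

lemma character_graph_root:
  assumes "character_graph R" "(a, z) \<in> R" "nmul m a = 0"
  shows "z ^ m = 1"
  using character_graph_nmul[OF assms(1,2), of m] assms(1,3) by (auto dest: character_graphD(3))

text \<open>Both values are inverse to \<open>z ^ (m - 1)\<close>, which lies over
  \<open>- a\<close>.\<close>

lemma character_graph_unique:
  assumes bdd: "bounded_group TYPE('a::ab_group_add)"
    and R: "character_graph R" and az: "(a::'a, z) \<in> R" "(a, z') \<in> R"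
  shows "z = z'"
proof -
  obtain m where m: "m > 0" "\<And>x::'a. nmul m x = 0"
    using bounded_groupE[OF bdd] by blast
  have "(nmul (m - 1) a + a, z ^ (m - 1) * z') \<in> R"
    using R az by (intro character_graphD(2) character_graph_nmul)
  then have "z ^ (m - 1) * z' = 1"
    unfolding nmul_minus_one[OF m] using character_graphD(3)[OF R] by simp
  moreover have "z ^ (m - 1) * z = 1"
    using character_graph_root[OF R az(1) m(2)] m(1) by (metis power_minus_mult)
  ultimately show ?thesis
    by (metis mult_cancel_left mult_zero_left zero_neq_one)
qed

text \<open>What \<open>R\<close> and the single pair \<open>(g, w)\<close> generate together.
  Natural multiples of \<open>g\<close> are enough, since in a bounded group they include the
  negative ones.\<close>

definition extend_graph :: "('a::ab_group_add \<times> complex) set \<Rightarrow> 'a \<Rightarrow> complex \<Rightarrow> ('a \<times> complex) set"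
  where "extend_graph R g w = {(a + nmul k g, z * w ^ k) | a z k. (a, z) \<in> R}"

lemma extend_graph_superset: "R \<subseteq> extend_graph R g w"
  unfolding extend_graph_def
proof safe
  fix a z assume "(a, z) \<in> R"
  moreover have "a = a + nmul 0 g" "z = z * w ^ 0"
    by auto
  ultimately show "\<exists>a' z' k. (a, z) = (a' + nmul k g, z' * w ^ k) \<and> (a', z') \<in> R"
    by blast
qed

text \<open>Here \<open>d\<close> is the order of \<open>g\<close> modulo the domain of
  \<open>R\<close>, so the only constraint on \<open>w\<close> is that \<open>w ^ d\<close> be the
  value already given at \<open>nmul d g\<close>. If \<open>a + nmul k g = 0\<close>, divide
  \<open>k\<close> by \<open>d\<close>: minimality of \<open>d\<close> forces the remainder to
  vanish, and the pair over 0 then belongs to \<open>R\<close>.\<close>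

lemma character_graph_extend:
  assumes bdd: "bounded_group TYPE('a::ab_group_add)"
    and R: "character_graph R" and d: "d > 0" "(nmul d (g::'a), w ^ d) \<in> R"
    and d_min: "\<And>r. 0 < r \<Longrightarrow> r < d \<Longrightarrow> nmul r g \<notin> fst ` R"
  shows "character_graph (extend_graph R g w)" "(g, w) \<in> extend_graph R g w"
proof -
  obtain m where m: "m > 0" "\<And>x::'a. nmul m x = 0"
    using bounded_groupE[OF bdd] by blast
  have single: "z * w ^ k = 1" if az: "(a, z) \<in> R" and 0: "a + nmul k g = 0" for a z k
  proof -
    define q r where "q = k div d" and "r = k mod d"
    have k: "k = q * d + r" and "r < d"
      using d by (auto simp: q_def r_def)
    have Rq: "(a + nmul (q * d) g, z * w ^ (q * d)) \<in> R"
      using character_graphD(2)[OF R az character_graph_nmul[OF R d(2), of q]]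
      by (simp add: nmul_mult power_mult[symmetric] mult.commute[of d q])
    \<comment> \<open>The remainder multiple is a negative of a domain element, hence a multiple of
      one, hence in the domain.\<close>
    have "nmul r g = - (a + nmul (q * d) g)"
      using 0 k by (simp add: nmul_add_left eq_neg_iff_add_eq_0 algebra_simps)
    also have "\<dots> = nmul (m - 1) (a + nmul (q * d) g)"
      using nmul_minus_one[OF m] by metis
    also have "\<dots> \<in> fst ` R"
      using character_graph_nmul[OF R Rq, of "m - 1"] by force
    finally have "r = 0"
      using d_min[of r] \<open>r < d\<close> by auto
    with Rq k 0 show ?thesis
      using R by (auto dest: character_graphD(3))
  qed
  have "(a + b, z * v) \<in> extend_graph R g w"
    if "(a, z) \<in> extend_graph R g w" "(b, v) \<in> extend_graph R g w" for a z b v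
  proof -
    from that obtain a' z' k b' v' l where *: "(a', z') \<in> R" "(b', v') \<in> R"
      "a = a' + nmul k g" "z = z' * w ^ k" "b = b' + nmul l g" "v = v' * w ^ l"
      unfolding extend_graph_def by blast
    then have "(a' + b', z' * v') \<in> R"
      using R by (auto intro: character_graphD(2))
    moreover have "a + b = (a' + b') + nmul (k + l) g" "z * v = (z' * v') * w ^ (k + l)"
      using * by (auto simp: nmul_add_left power_add algebra_simps)
    ultimately show ?thesis
      unfolding extend_graph_def by blast
  qed
  moreover have "(0, 1) \<in> extend_graph R g w"
    using extend_graph_superset character_graphD(1)[OF R] by blast
  moreover have "v = 1" if "(0, v) \<in> extend_graph R g w" for v
    using that single unfolding extend_graph_def by auto
  ultimately show "character_graph (extend_graph R g w)"
    unfolding character_graph_def by blast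
  have "g = 0 + nmul 1 g" "w = 1 * w ^ 1"
    by simp_all
  then show "(g, w) \<in> extend_graph R g w"
    using character_graphD(1)[OF R] unfolding extend_graph_def by blast
qed

lemma least_multiple_in_domain:
  assumes bdd: "bounded_group TYPE('a::ab_group_add)" and R: "character_graph R"
  obtains d where "d > 0" "nmul d (g::'a) \<in> fst ` R"
    "\<And>r. 0 < r \<Longrightarrow> r < d \<Longrightarrow> nmul r g \<notin> fst ` R"
proof -
  obtain m where m: "m > 0" "\<And>x::'a. nmul m x = 0"
    using bounded_groupE[OF bdd] by blast
  have "0 \<in> fst ` R"
    using character_graphD(1)[OF R] by force
  then have ex: "\<exists>d. d > 0 \<and> nmul d g \<in> fst ` R"
    using m by metis
  show thesis
    using LeastI_ex[OF ex] not_less_Least that by blast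
qed

text \<open>Zorn's lemma gives a maximal graph containing \<open>R\<close>. It is total, because any
  \<open>g\<close> can be adjoined by choosing a suitable root as its value, so it is the graph of a
  character.\<close>

lemma character_graph_extends_to_character:
  assumes bdd: "bounded_group TYPE('a::ab_group_add)" and R: "character_graph R"
  shows "\<exists>\<phi>\<in>characters. \<forall>x::'a. \<forall>z. (x, z) \<in> R \<longrightarrow> \<phi> x = z"
proof -
  define \<A> where "\<A> = {S. character_graph S \<and> R \<subseteq> S}"
  have "\<Union>\<C> \<in> \<A>" if "\<C> \<noteq> {}" and chain: "subset.chain \<A> \<C>" for \<C>
  proof -
    have mem: "character_graph S" "R \<subseteq> S" if "S \<in> \<C>" for S
      using that chain by (auto simp: \<A>_def subset.chain_def)
    have "(a + b, z * w) \<in> \<Union>\<C>" if "(a, z) \<in> \<Union>\<C>" "(b, w) \<in> \<Union>\<C>" for a z b w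
    proof -
      from that obtain S T where "S \<in> \<C>" "T \<in> \<C>" "(a, z) \<in> S" "(b, w) \<in> T"
        by blast
      moreover from this have "S \<subseteq> T \<or> T \<subseteq> S"
        using chain by (auto simp: subset.chain_def)
      ultimately show ?thesis
        using mem by (meson UnionI character_graphD(2) subsetD)
    qed
    moreover have "(0, 1) \<in> \<Union>\<C>"
      using mem \<open>\<C> \<noteq> {}\<close> character_graphD(1) by blast
    moreover have "z = 1" if "(0, z) \<in> \<Union>\<C>" for z
      using that mem character_graphD(3) by blast
    ultimately have "character_graph (\<Union>\<C>)"
      unfolding character_graph_def by blast
    then show ?thesis
      using mem \<open>\<C> \<noteq> {}\<close> by (auto simp: \<A>_def)
  qed
  moreover have "\<A> \<noteq> {}"
    using R by (auto simp: \<A>_def)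
  ultimately obtain M where M: "M \<in> \<A>" and max: "\<And>X. X \<in> \<A> \<Longrightarrow> M \<subseteq> X \<Longrightarrow> X = M"
    using subset_Zorn_nonempty[of \<A>] by metis
  have cM: "character_graph M" and "R \<subseteq> M"
    using M by (auto simp: \<A>_def)
  obtain m where m: "m > 0" "\<And>x::'a. nmul m x = 0"
    using bounded_groupE[OF bdd] by blast
  \<comment> \<open>Graphs do not ask for values on the circle; this follows from the values being
    roots of unity.\<close>
  have norm_M: "norm z = 1" if "(a, z) \<in> M" for a z
  proof -
    have "norm z ^ m = 1 ^ m"
      using character_graph_root[OF cM that m(2)] by (metis norm_one norm_power power_one)
    then show ?thesis
      using m(1) power_eq_iff_eq_base[of m "norm z" 1] by simp
  qed
  have total: "\<exists>z. (g, z) \<in> M" for g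
  proof -
    obtain d where d: "d > 0" "nmul d g \<in> fst ` M"
      "\<And>r. 0 < r \<Longrightarrow> r < d \<Longrightarrow> nmul r g \<notin> fst ` M"
      using least_multiple_in_domain[OF bdd cM] by metis
    then obtain z where z: "(nmul d g, z) \<in> M"
      by force
    \<comment> \<open>A \<open>d\<close>-th root of the value prescribed at
      \<open>nmul d g\<close>.\<close>
    define w where "w = exp (Ln z / of_nat d)"
    have "z \<noteq> 0"
      using norm_M[OF z] by auto
    then have "w ^ d = z"
      using d(1) by (auto simp: w_def exp_of_nat_mult[symmetric])
    then have ext: "character_graph (extend_graph M g w)" "(g, w) \<in> extend_graph M g w"
      using character_graph_extend[OF bdd cM, of d g w] d z by auto
    then have "extend_graph M g w = M"
      using max extend_graph_superset \<open>R \<subseteq> M\<close> by (metis (mono_tags, lifting) \<A>_def mem_Collect_eq subset_trans)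
    then show ?thesis
      using ext(2) by auto
  qed
  then obtain \<phi> where \<phi>: "\<And>g. (g, \<phi> g) \<in> M"
    by metis
  have "\<phi> (x + y) = \<phi> x * \<phi> y" for x y
    using character_graph_unique[OF bdd cM] character_graphD(2)[OF cM \<phi> \<phi>] \<phi> by blast
  moreover have "\<phi> x \<in> circle" for x
    using norm_M[OF \<phi>] by (simp add: circle_def)
  moreover have "\<phi> x = z" if "(x, z) \<in> R" for x z
    using character_graph_unique[OF bdd cM \<phi>] that \<open>R \<subseteq> M\<close> by blast
  ultimately show ?thesis
    unfolding characters_def by blast
qed

text \<open>Extend the trivial character of \<open>U\<close> to \<open>x\<close>. The order
  \<open>d\<close> of \<open>x\<close> modulo \<open>U\<close> exceeds 1, so a \<open>d\<close>-th
  root of unity other than 1 is available as the value at \<open>x\<close>.\<close>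

lemma character_separates_subgroup:
  assumes bdd: "bounded_group TYPE('a::ab_group_add)"
    and U: "additive_subgroup U" and x: "(x::'a) \<notin> U"
  obtains \<phi> where "\<phi> \<in> characters" "\<And>u. u \<in> U \<Longrightarrow> \<phi> u = 1" "\<phi> x \<noteq> 1"
proof -
  define R where "R = U \<times> {1::complex}"
  have R: "character_graph R"
    using additive_subgroupD[OF U] by (auto simp: character_graph_def R_def)
  have fst_R: "fst ` R = U"
    by (auto simp: R_def)
  obtain d where d: "d > 0" "nmul d x \<in> U" "\<And>r. 0 < r \<Longrightarrow> r < d \<Longrightarrow> nmul r x \<notin> U"
    using least_multiple_in_domain[OF bdd R, of x] unfolding fst_R by blast
  have "d \<noteq> 1"
    using d(2) x by auto
  then have "card {z::complex. z ^ d = 1} > 1"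
    using d(1) card_roots_unity_eq[OF d(1)] by simp
  then have "\<not> {z::complex. z ^ d = 1} \<subseteq> {1}"
    using card_mono[of "{1}" "{z::complex. z ^ d = 1}"] by auto
  then obtain w :: complex where w: "w ^ d = 1" "w \<noteq> 1"
    by blast
  have ext: "character_graph (extend_graph R x w)" "(x, w) \<in> extend_graph R x w"
    using character_graph_extend[OF bdd R d(1), of x w] d(2,3) w(1) unfolding fst_R
    by (simp_all add: R_def)
  obtain \<phi> where \<phi>: "\<phi> \<in> characters" "\<And>y z. (y, z) \<in> extend_graph R x w \<Longrightarrow> \<phi> y = z"
    using character_graph_extends_to_character[OF bdd ext(1)] by metis
  show thesis
  proof (rule that[OF \<phi>(1)])
    show "\<phi> u = 1" if "u \<in> U" for u
    proof -
      have "(u, 1) \<in> R"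
        using that by (simp add: R_def)
      then show ?thesis
        using \<phi>(2) extend_graph_superset by blast
    qed
    show "\<phi> x \<noteq> 1"
      using \<phi>(2)[OF ext(2)] w by simp
  qed
qed

section \<open>Linear topologies and their precompact modifications\<close>

definition subgroup_base :: "'a::ab_group_add set set \<Rightarrow> bool" where
  "subgroup_base \<U> \<longleftrightarrow> \<U> \<noteq> {} \<and> (\<forall>U\<in>\<U>. additive_subgroup U) \<and>
     (\<forall>U\<in>\<U>. \<forall>V\<in>\<U>. \<exists>W\<in>\<U>. W \<subseteq> U \<inter> V)"

definition linear_topology :: "'a::ab_group_add set set \<Rightarrow> 'a topology" where
  "linear_topology \<U> = topology (\<lambda>V. \<forall>x\<in>V. \<exists>U\<in>\<U>. \<forall>u\<in>U. x + u \<in> V)"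

context
  fixes \<U> :: "'a::ab_group_add set set"
  assumes base: "subgroup_base \<U>"
begin

lemma subgroup_baseD:
  shows "\<exists>U. U \<in> \<U>" "U \<in> \<U> \<Longrightarrow> additive_subgroup U"
    "U \<in> \<U> \<Longrightarrow> V \<in> \<U> \<Longrightarrow> \<exists>W\<in>\<U>. W \<subseteq> U \<inter> V"
  using base unfolding subgroup_base_def by auto

lemma openin_linear_topology:
  "openin (linear_topology \<U>) V \<longleftrightarrow> (\<forall>x\<in>V. \<exists>U\<in>\<U>. \<forall>u\<in>U. x + u \<in> V)"
proof -
  have "istopology (\<lambda>V. \<forall>x\<in>V. \<exists>U\<in>\<U>. \<forall>u\<in>U. x + u \<in> V)"
    unfolding istopology_def
  proof (intro conjI allI impI ballI)
    fix S T x
    assume "\<forall>x\<in>S. \<exists>U\<in>\<U>. \<forall>u\<in>U. x + u \<in> S" "\<forall>x\<in>T. \<exists>U\<in>\<U>. \<forall>u\<in>U. x + u \<in> T" "x \<in> S \<inter> T"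
    then obtain U U' where "U \<in> \<U>" "\<forall>u\<in>U. x + u \<in> S" "U' \<in> \<U>" "\<forall>u\<in>U'. x + u \<in> T"
      by blast
    then show "\<exists>U\<in>\<U>. \<forall>u\<in>U. x + u \<in> S \<inter> T"
      using subgroup_baseD(3)[of U U'] by blast
  next
    fix \<K> x
    assume *: "\<forall>K\<in>\<K>. \<forall>x\<in>K. \<exists>U\<in>\<U>. \<forall>u\<in>U. x + u \<in> K" "x \<in> \<Union> \<K>"
    then obtain K where "K \<in> \<K>" "x \<in> K"
      by blast
    then obtain U where "U \<in> \<U>" "\<forall>u\<in>U. x + u \<in> K"
      using *(1) by blast
    then show "\<exists>U\<in>\<U>. \<forall>u\<in>U. x + u \<in> \<Union> \<K>"
      using \<open>K \<in> \<K>\<close> by blast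
  qed
  then show ?thesis
    by (simp add: linear_topology_def)
qed

lemma topspace_linear_topology: "topspace (linear_topology \<U>) = UNIV"
proof -
  have "openin (linear_topology \<U>) UNIV"
    unfolding openin_linear_topology using subgroup_baseD(1) by blast
  then show ?thesis
    using openin_subset by blast
qed

text \<open>The set is the coset of \<open>U\<close> through \<open>x\<close>; cosets serve as the
  basic open sets below.\<close>

lemma openin_linear_coset:
  assumes "U \<in> \<U>" shows "openin (linear_topology \<U>) {y. y - x \<in> U}"
  unfolding openin_linear_topology
proof
  fix y assume "y \<in> {y. y - x \<in> U}"
  then have "\<forall>u\<in>U. y + u \<in> {y. y - x \<in> U}"
    using additive_subgroupD(2)[OF subgroup_baseD(2)[OF assms], of "y - x"]
    by (auto simp: add_diff_eq add.commute diff_add_eq)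
  then show "\<exists>V\<in>\<U>. \<forall>v\<in>V. y + v \<in> {y. y - x \<in> U}"
    using assms by blast
qed

lemma openin_linear_base:
  assumes "U \<in> \<U>" shows "openin (linear_topology \<U>) U"
  using openin_linear_coset[OF assms, of 0] by simp

lemma group_topology_linear: "group_topology (linear_topology \<U>)"
  unfolding group_topology_def
proof (intro conjI)
  show "continuous_map (prod_topology (linear_topology \<U>) (linear_topology \<U>))
          (linear_topology \<U>) (\<lambda>(x, y). x + y)"
    unfolding continuous_map_def topspace_prod_topology topspace_linear_topology
  proof (intro conjI allI impI)
    fix V assume V: "openin (linear_topology \<U>) V"
    show "openin (prod_topology (linear_topology \<U>) (linear_topology \<U>))
            {x \<in> UNIV \<times> UNIV. (case x of (x, y) \<Rightarrow> x + y) \<in> V}"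
      unfolding openin_prod_topology_alt
    proof (intro allI impI)
      fix x y assume "(x, y) \<in> {x \<in> UNIV \<times> UNIV. (case x of (x, y) \<Rightarrow> x + y) \<in> V}"
      then obtain U where U: "U \<in> \<U>" "\<And>u. u \<in> U \<Longrightarrow> x + y + u \<in> V"
        using V unfolding openin_linear_topology by auto
      have sub: "additive_subgroup U"
        using U subgroup_baseD(2) by blast
      have "a + b \<in> V" if "a - x \<in> U" "b - y \<in> U" for a b
        using U(2)[OF additive_subgroupD(2)[OF sub that]] by (simp add: algebra_simps)
      then have "{a. a - x \<in> U} \<times> {b. b - y \<in> U} \<subseteq>
          {x \<in> UNIV \<times> UNIV. (case x of (x, y) \<Rightarrow> x + y) \<in> V}"
        by auto
      moreover have "x \<in> {a. a - x \<in> U}" "y \<in> {b. b - y \<in> U}"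
        using additive_subgroupD(1)[OF sub] by auto
      ultimately show "\<exists>S T. openin (linear_topology \<U>) S \<and> openin (linear_topology \<U>) T \<and>
          x \<in> S \<and> y \<in> T \<and> S \<times> T \<subseteq> {x \<in> UNIV \<times> UNIV. (case x of (x, y) \<Rightarrow> x + y) \<in> V}"
        using openin_linear_coset[OF U(1)] by meson
    qed
  qed auto
  show "continuous_map (linear_topology \<U>) (linear_topology \<U>) uminus"
    unfolding continuous_map_def topspace_linear_topology
  proof (intro conjI allI impI)
    fix V assume V: "openin (linear_topology \<U>) V"
    show "openin (linear_topology \<U>) {x \<in> UNIV. - x \<in> V}"
      unfolding openin_linear_topology
    proof
      fix x assume "x \<in> {x \<in> UNIV. - x \<in> V}"
      then obtain U where U: "U \<in> \<U>" "\<And>u. u \<in> U \<Longrightarrow> - x + u \<in> V"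
        using V unfolding openin_linear_topology by auto
      then have "- (x + u) \<in> V" if "u \<in> U" for u
        using U(2)[of "- u"] additive_subgroupD(3)[OF subgroup_baseD(2)[OF U(1)]] that by simp
      then show "\<exists>U\<in>\<U>. \<forall>u\<in>U. x + u \<in> {x \<in> UNIV. - x \<in> V}"
        using U(1) by blast
    qed
  qed auto
qed (rule topspace_linear_topology)

lemma Hausdorff_linear_topology:
  assumes "\<Inter>\<U> = {0}"
  shows "Hausdorff_space (linear_topology \<U>)"
  unfolding Hausdorff_space_def
proof (intro allI impI)
  fix x y assume "x \<in> topspace (linear_topology \<U>) \<and> y \<in> topspace (linear_topology \<U>) \<and> x \<noteq> y"
  then have "x - y \<notin> \<Inter>\<U>"
    using assms by simp
  then obtain U where U: "U \<in> \<U>" "x - y \<notin> U"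
    by blast
  have sub: "additive_subgroup U"
    using U subgroup_baseD(2) by blast
  \<comment> \<open>Cosets of the subgroup \<open>U\<close> are equal or disjoint, and
    \<open>x\<close>, \<open>y\<close> lie in different ones.\<close>
  have "z - y \<notin> U" if "z - x \<in> U" for z
  proof
    assume "z - y \<in> U"
    then have "(z - y) - (z - x) \<in> U"
      using additive_subgroupD(4)[OF sub] that by blast
    then show False
      using U(2) by simp
  qed
  then have "disjnt {z. z - x \<in> U} {z. z - y \<in> U}"
    by (auto simp: disjnt_def)
  moreover have "x \<in> {z. z - x \<in> U}" "y \<in> {z. z - y \<in> U}"
    using additive_subgroupD(1)[OF sub] by auto
  ultimately show "\<exists>V W. openin (linear_topology \<U>) V \<and> openin (linear_topology \<U>) W \<and>
      x \<in> V \<and> y \<in> W \<and> disjnt V W"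
    using openin_linear_coset[OF U(1)] by meson
qed

text \<open>A character close to 1 on a member of the base is 1 there, because its values are roots of
  unity and form a group.\<close>
lemma dual_linear_topology:
  assumes bdd: "bounded_group TYPE('a)"
  shows "dual_group (linear_topology \<U>) = {\<phi> \<in> characters. \<exists>U\<in>\<U>. \<forall>u\<in>U. \<phi> u = 1}"
proof (intro set_eqI iffI)
  fix \<phi> assume "\<phi> \<in> dual_group (linear_topology \<U>)"
  then have cont: "continuous_map (linear_topology \<U>) (top_of_set circle) \<phi>"
    and add: "\<And>x y. \<phi> (x + y) = \<phi> x * \<phi> y"
    by (auto simp: dual_group_def)
  have "\<phi> x \<in> circle" for x
    using continuous_map_image_subset_topspace[OF cont] by (auto simp: topspace_linear_topology)
  then have \<phi>: "\<phi> \<in> characters"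
    using add by (simp add: characters_def)
  obtain m where m: "m > 0" "\<And>x::'a. nmul m x = 0"
    using bounded_groupE[OF bdd] by blast
  have "openin (top_of_set circle) (circle \<inter> {z. Re z > 0})"
    by (intro openin_open_Int open_halfspace_Re_gt)
  then have "openin (linear_topology \<U>) {x \<in> UNIV. \<phi> x \<in> circle \<inter> {z. Re z > 0}}"
    using cont unfolding continuous_map_def topspace_linear_topology by blast
  moreover have "0 \<in> {x \<in> UNIV. \<phi> x \<in> circle \<inter> {z. Re z > 0}}"
    using character_zero[OF \<phi>] by (simp add: circle_def)
  ultimately obtain U where U: "U \<in> \<U>" "\<And>u. u \<in> U \<Longrightarrow> Re (\<phi> u) > 0"
    unfolding openin_linear_topology by fastforce
  have "\<phi> u = 1" if "u \<in> U" for u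
  proof (rule ccontr)
    assume "\<phi> u \<noteq> 1"
    moreover have "\<phi> u ^ m = 1"
      using character_nmul[OF \<phi>] character_zero[OF \<phi>] m(2) by metis
    ultimately obtain j where "Re (\<phi> u ^ j) < 0"
      using root_of_unity_power_Re_neg[OF m(1)] by blast
    moreover have "Re (\<phi> u ^ j) > 0"
      using U(2)[OF nmul_mem[OF subgroup_baseD(2)[OF U(1)] that, of j]] character_nmul[OF \<phi>] by metis
    ultimately show False
      by simp
  qed
  with \<phi> U show "\<phi> \<in> {\<phi> \<in> characters. \<exists>U\<in>\<U>. \<forall>u\<in>U. \<phi> u = 1}"
    by blast
next
  fix \<phi> assume "\<phi> \<in> {\<phi> \<in> characters. \<exists>U\<in>\<U>. \<forall>u\<in>U. \<phi> u = 1}"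
  then obtain U where \<phi>: "\<phi> \<in> characters" and U: "U \<in> \<U>" "\<And>u. u \<in> U \<Longrightarrow> \<phi> u = 1"
    by blast
  \<comment> \<open>A character trivial on \<open>U\<close> is constant on cosets of
    \<open>U\<close>, so the preimage of any set whatever is open.\<close>
  have "openin (linear_topology \<U>) {x \<in> UNIV. \<phi> x \<in> W}" for W
    unfolding openin_linear_topology using U by (auto simp: character_add[OF \<phi>] intro!: bexI[of _ U])
  moreover have "\<phi> \<in> UNIV \<rightarrow> circle"
    using \<phi> by (simp add: characters_def)
  ultimately show "\<phi> \<in> dual_group (linear_topology \<U>)"
    using \<phi> unfolding dual_group_def continuous_map_def topspace_linear_topology
    by (auto simp: characters_def)
qed

text \<open>Basic subgroups are quasi-convex: take a character trivial on \<open>U\<close> but not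
  at \<open>x\<close>. A suitable power of it has negative real part at \<open>x\<close> and is
  still 1 on \<open>U\<close>.\<close>

lemma locally_quasi_convex_linear:
  assumes bdd: "bounded_group TYPE('a)" and sep: "\<Inter>\<U> = {0}"
  shows "locally_quasi_convex (linear_topology \<U>)"
proof -
  have "quasi_convex (linear_topology \<U>) U" if "U \<in> \<U>" for U
    unfolding quasi_convex_def
  proof (intro allI impI)
    fix x assume "x \<notin> U"
    then obtain \<phi> where \<phi>: "\<phi> \<in> characters" "\<And>u. u \<in> U \<Longrightarrow> \<phi> u = 1" "\<phi> x \<noteq> 1"
      using character_separates_subgroup[OF bdd subgroup_baseD(2)[OF \<open>U \<in> \<U>\<close>]] by metis
    obtain m where m: "m > 0" "\<And>x::'a. nmul m x = 0"
      using bounded_groupE[OF bdd] by blast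
    have "\<phi> x ^ m = 1"
      using character_nmul[OF \<phi>(1)] character_zero[OF \<phi>(1)] m(2) by metis
    then obtain j where j: "Re (\<phi> x ^ j) < 0"
      using root_of_unity_power_Re_neg[OF m(1)] \<phi>(3) by blast
    show "\<exists>\<phi>\<in>dual_group (linear_topology \<U>). \<phi> ` U \<subseteq> circle_plus \<and> \<phi> x \<notin> circle_plus"
    proof (intro bexI conjI)
      show "(\<lambda>x. \<phi> x ^ j) \<in> dual_group (linear_topology \<U>)"
        unfolding dual_linear_topology[OF bdd] using power_character[OF \<phi>(1)] \<phi>(2) \<open>U \<in> \<U>\<close>
          by (auto intro!: bexI[of _ U])
      show "(\<lambda>x. \<phi> x ^ j) ` U \<subseteq> circle_plus"
        using \<phi>(2) by (auto simp: circle_plus_def circle_def)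
      show "\<phi> x ^ j \<notin> circle_plus"
        using j by (simp add: circle_plus_def)
    qed
  qed
  moreover have "\<exists>U\<in>\<U>. U \<subseteq> W" if W: "openin (linear_topology \<U>) W" "0 \<in> W" for W
    using W unfolding openin_linear_topology by (metis add_0 subsetI)
  ultimately have "neighbourhood_base_at 0 (quasi_convex (linear_topology \<U>)) (linear_topology \<U>)"
    unfolding neighbourhood_base_at_def
    by (meson openin_linear_base additive_subgroupD(1) subgroup_baseD(2) order_refl)
  then show ?thesis
    using group_topology_linear Hausdorff_linear_topology[OF sep]
    by (simp add: locally_quasi_convex_def)
qed

end

section \<open>Annihilators and the topologies they define\<close>

definition annihilator :: "('a::ab_group_add \<Rightarrow> complex) set \<Rightarrow> 'a set" where
  "annihilator \<Phi> = {x. \<forall>\<phi>\<in>\<Phi>. \<phi> x = 1}"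

lemma additive_subgroup_annihilator:
  "\<Phi> \<subseteq> characters \<Longrightarrow> additive_subgroup (annihilator \<Phi>)"
  by (auto simp: additive_subgroup_def annihilator_def character_zero character_add character_minus
      subset_iff)

text \<open>In other words, the annihilator has finite index. Points with the same tuple of values
  under \<open>\<Phi>\<close> differ by an element of it, and only finitely many tuples
  occur.\<close>

lemma finite_transversal_annihilator:
  assumes bdd: "bounded_group TYPE('a::ab_group_add)"
    and \<Phi>: "finite \<Phi>" "\<Phi> \<subseteq> (characters :: ('a \<Rightarrow> complex) set)"
  shows "\<exists>F. finite F \<and> (\<forall>x. \<exists>f\<in>F. x - f \<in> annihilator \<Phi>)"
proof -
  obtain R where R: "finite R" "\<And>\<phi> x. \<phi> \<in> characters \<Longrightarrow> \<phi> (x::'a) \<in> R"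
    using character_values_finite[OF bdd] by blast
  define v where "v = (\<lambda>x. \<lambda>\<phi>\<in>\<Phi>. \<phi> (x::'a))"
  have "range v \<subseteq> PiE \<Phi> (\<lambda>_. R)"
    using R(2) \<Phi>(2) by (auto simp: v_def)
  then have "finite (range v)"
    by (rule finite_subset) (simp add: finite_PiE \<Phi>(1) R(1))
  then obtain F where F: "finite F" "range v = v ` F"
    using finite_subset_image[of "range v" v UNIV] by auto
  have "\<exists>f\<in>F. x - f \<in> annihilator \<Phi>" for x
  proof -
    obtain f where "f \<in> F" "v x = v f"
      using F(2) by blast
    have "\<phi> (x - f) = 1" if "\<phi> \<in> \<Phi>" for \<phi>
    proof -
      have "\<phi> \<in> characters"
        using that \<Phi>(2) by blast
      moreover have "\<phi> x = \<phi> f"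
        using that \<open>v x = v f\<close> by (metis restrict_apply' v_def)
      ultimately show ?thesis
        by (simp add: character_diff character_nonzero)
    qed
    then show ?thesis
      using \<open>f \<in> F\<close> by (auto simp: annihilator_def)
  qed
  then show ?thesis
    using F(1) by blast
qed

text \<open>Such a character is determined by its restriction to a finite transversal, and its
  values lie in a fixed finite set. This finiteness drives both the weight bound and the failure of
  the Mackey property.\<close>

lemma finite_characters_trivial_on_annihilator:
  assumes bdd: "bounded_group TYPE('a::ab_group_add)"
    and \<Phi>: "finite \<Phi>" "\<Phi> \<subseteq> (characters :: ('a \<Rightarrow> complex) set)"
  shows "finite {\<phi> \<in> characters. \<forall>x\<in>annihilator \<Phi>. \<phi> x = 1}" (is "finite ?C")
proof -
  obtain F where F: "finite F" "\<And>x. \<exists>f\<in>F. x - f \<in> annihilator \<Phi>"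
    using finite_transversal_annihilator[OF bdd \<Phi>] by blast
  obtain R where R: "finite R" "\<And>\<phi> x. \<phi> \<in> characters \<Longrightarrow> \<phi> (x::'a) \<in> R"
    using character_values_finite[OF bdd] by blast
  have "inj_on (\<lambda>\<phi>. restrict \<phi> F) ?C"
  proof (rule inj_onI, rule ext)
    fix \<phi> \<psi> x assume \<phi>: "\<phi> \<in> ?C" and \<psi>: "\<psi> \<in> ?C" and eq: "restrict \<phi> F = restrict \<psi> F"
    obtain f where f: "f \<in> F" "x - f \<in> annihilator \<Phi>"
      using F(2) by blast
    have *: "\<theta> x = \<theta> f" if "\<theta> \<in> ?C" for \<theta>
    proof -
      have "\<theta> \<in> characters" "\<theta> (x - f) = 1"
        using that f(2) by blast+
      then show ?thesis
        using character_diff[of \<theta> x f] character_nonzero[of \<theta> f] by simp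
    qed
    have "\<phi> f = \<psi> f"
      using fun_cong[OF eq, of f] f(1) by simp
    then show "\<phi> x = \<psi> x"
      unfolding *[OF \<phi>] *[OF \<psi>] .
  qed
  moreover have "(\<lambda>\<phi>. restrict \<phi> F) ` ?C \<subseteq> PiE F (\<lambda>_. R)"
    using R(2) by auto
  ultimately show ?thesis
    by (rule inj_on_finite) (simp add: finite_PiE F(1) R(1))
qed

text \<open>On a bounded group this is the coarsest topology making the characters in
  \<open>H\<close> continuous: their values form finite sets, so kernels are open and finite
  intersections of kernels form a base at 0. This form makes it a linear topology.\<close>

definition weak_topology :: "('a::ab_group_add \<Rightarrow> complex) set \<Rightarrow> 'a topology" where
  "weak_topology H = linear_topology (annihilator ` Fpow H)"

lemma subgroup_base_weak:
  assumes "H \<subseteq> characters"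
  shows "subgroup_base (annihilator ` Fpow H)"
  unfolding subgroup_base_def
proof (intro conjI ballI)
  show "annihilator ` Fpow H \<noteq> {}"
    by (auto simp: Fpow_def)
  show "additive_subgroup U" if U: "U \<in> annihilator ` Fpow H" for U
  proof -
    obtain \<Phi> where "U = annihilator \<Phi>" "\<Phi> \<subseteq> H"
      using U by (auto simp: Fpow_def)
    then show ?thesis
      using assms additive_subgroup_annihilator[of \<Phi>] by simp
  qed
  fix U V assume "U \<in> annihilator ` Fpow H" "V \<in> annihilator ` Fpow H"
  then obtain \<Phi> \<Psi> where *: "U = annihilator \<Phi>" "V = annihilator \<Psi>" "\<Phi> \<union> \<Psi> \<in> Fpow H"
    by (auto simp: Fpow_def)
  have "annihilator (\<Phi> \<union> \<Psi>) = U \<inter> V"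
    unfolding * by (auto simp: annihilator_def)
  then show "\<exists>W\<in>annihilator ` Fpow H. W \<subseteq> U \<inter> V"
    using *(3) by (metis image_eqI order_refl)
qed

lemma openin_weak_topology:
  assumes "H \<subseteq> characters"
  shows "openin (weak_topology H) V \<longleftrightarrow>
    (\<forall>x\<in>V. \<exists>\<Phi>. finite \<Phi> \<and> \<Phi> \<subseteq> H \<and> (\<forall>u\<in>annihilator \<Phi>. x + u \<in> V))"
  unfolding weak_topology_def openin_linear_topology[OF subgroup_base_weak[OF assms]]
  by (simp add: Fpow_def conj_ac)

text \<open>Every neighbourhood of 0 contains the annihilator of a finite set, which has finite
  index. The topology is Hausdorff because the annihilators of finite subsets of \<open>H\<close>
  meet in the annihilator of \<open>H\<close>.\<close>

lemma precompact_weak_topology: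
  assumes bdd: "bounded_group TYPE('a::ab_group_add)"
    and H: "H \<subseteq> (characters :: ('a \<Rightarrow> complex) set)" and sep: "annihilator H = {0}"
  shows "precompact (weak_topology H)"
  unfolding precompact_def
proof (intro conjI allI impI)
  note base = subgroup_base_weak[OF H]
  show "group_topology (weak_topology H)"
    unfolding weak_topology_def by (rule group_topology_linear[OF base])
  have "x \<in> annihilator H" if x: "\<forall>\<Phi>\<in>Fpow H. x \<in> annihilator \<Phi>" for x
  proof -
    have "x \<in> annihilator {\<phi>}" if "\<phi> \<in> H" for \<phi>
      using x that by (simp add: Fpow_def)
    then show ?thesis
      by (simp add: annihilator_def)
  qed
  then have "\<Inter>(annihilator ` Fpow H) \<subseteq> {0}"
    unfolding sep[symmetric] by auto
  moreover have "0 \<in> \<Inter>(annihilator ` Fpow H)"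
    using subgroup_baseD(2)[OF base] additive_subgroupD(1) by blast
  ultimately have "\<Inter>(annihilator ` Fpow H) = {0}"
    by blast
  then show "Hausdorff_space (weak_topology H)"
    unfolding weak_topology_def by (rule Hausdorff_linear_topology[OF base])
  fix U V assume "openin (weak_topology H) V \<and> 0 \<in> V \<and> V \<subseteq> U"
  then obtain \<Phi> where \<Phi>: "finite \<Phi>" "\<Phi> \<subseteq> H" "annihilator \<Phi> \<subseteq> U"
    unfolding openin_weak_topology[OF H] by fastforce
  obtain F where F: "finite F" "\<And>x. \<exists>f\<in>F. x - f \<in> annihilator \<Phi>"
    using finite_transversal_annihilator[OF bdd \<Phi>(1)] \<Phi>(2) H by blast
  have "x \<in> F + U" for x
  proof -
    obtain f where "f \<in> F" "x - f \<in> U"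
      using F(2) \<Phi>(3) by blast
    then have "f + (x - f) \<in> F + U"
      by (rule set_plus_intro)
    then show ?thesis
      by simp
  qed
  then show "\<exists>F. finite F \<and> F + U = UNIV"
    using F(1) by blast
qed

text \<open>Passing to the precompact topology adds no characters: the annihilator of finitely many
  members of the dual contains a basic subgroup, so a character trivial on that annihilator was
  already continuous.\<close>

lemma dual_weak_topology:
  fixes \<U> :: "'a::ab_group_add set set"
  assumes bdd: "bounded_group TYPE('a)" and base: "subgroup_base \<U>"
  shows "dual_group (weak_topology (dual_group (linear_topology \<U>))) =
    dual_group (linear_topology \<U>)"
proof -
  define H where "H = dual_group (linear_topology \<U>)"
  have H: "H = {\<phi> \<in> characters. \<exists>U\<in>\<U>. \<forall>u\<in>U. \<phi> u = 1}"
    unfolding H_def by (rule dual_linear_topology[OF base bdd])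
  then have H_char: "H \<subseteq> characters"
    by blast
  have trivial: "\<exists>U\<in>\<U>. U \<subseteq> annihilator \<Phi>" if "finite \<Phi>" "\<Phi> \<subseteq> H" for \<Phi>
    using that
  proof (induction \<Phi>)
    case empty
    then show ?case
      using subgroup_baseD(1)[OF base] by (auto simp: annihilator_def)
  next
    case (insert \<phi> \<Phi>)
    then obtain U V where "U \<in> \<U>" "U \<subseteq> annihilator \<Phi>" "V \<in> \<U>" "\<forall>v\<in>V. \<phi> v = 1"
      using H by blast
    moreover from this obtain W where "W \<in> \<U>" "W \<subseteq> U \<inter> V"
      using subgroup_baseD(3)[OF base] by blast
    ultimately show ?case
      by (intro bexI[of _ W]) (auto simp: annihilator_def)
  qed
  have "dual_group (weak_topology H) = H"
    unfolding weak_topology_def dual_linear_topology[OF subgroup_base_weak[OF H_char] bdd]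
  proof (intro set_eqI iffI)
    fix \<phi> assume "\<phi> \<in> {\<phi> \<in> characters. \<exists>U\<in>annihilator ` Fpow H. \<forall>u\<in>U. \<phi> u = 1}"
    then obtain \<Phi> where \<phi>: "\<phi> \<in> characters" "finite \<Phi>" "\<Phi> \<subseteq> H" "\<forall>u\<in>annihilator \<Phi>. \<phi> u = 1"
      by (auto simp: Fpow_def)
    then show "\<phi> \<in> H"
      unfolding H using trivial[OF \<phi>(2,3)] by blast
  next
    fix \<phi> assume "\<phi> \<in> H"
    then have "annihilator {\<phi>} \<in> annihilator ` Fpow H" "\<phi> \<in> characters"
      using H_char by (auto simp: Fpow_def)
    then show "\<phi> \<in> {\<phi> \<in> characters. \<exists>U\<in>annihilator ` Fpow H. \<forall>u\<in>U. \<phi> u = 1}"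
      by (auto simp: annihilator_def)
  qed
  then show ?thesis
    by (simp add: H_def)
qed

section \<open>Weight\<close>

text \<open>Encode a point by its image and its number within the fibre. The resulting factor
  \<open>nat\<close> is absorbed by the infinite image.\<close>

lemma lepoll_image_finite_fibres:
  assumes "infinite X" and fibres: "\<And>b. finite {x \<in> X. f x = b}"
  shows "X \<lesssim> f ` X"
proof -
  have inf: "infinite (f ` X)"
  proof
    assume "finite (f ` X)"
    then have "finite (\<Union>b\<in>f ` X. {x \<in> X. f x = b})"
      using fibres by blast
    moreover have "X = (\<Union>b\<in>f ` X. {x \<in> X. f x = b})"
      by auto
    ultimately show False
      using assms(1) by simp
  qed
  define g where "g x = (f x, to_nat_on {x' \<in> X. f x' = f x} x)" for x
  have "inj_on g X"
  proof (rule inj_onI)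
    fix x y assume xy: "x \<in> X" "y \<in> X" "g x = g y"
    then have "f x = f y"
      "to_nat_on {x' \<in> X. f x' = f y} x = to_nat_on {x' \<in> X. f x' = f y} y"
      by (auto simp: g_def)
    then show "x = y"
      using xy inj_on_to_nat_on[OF countable_finite[OF fibres[of "f y"]]] by (auto dest: inj_onD)
  qed
  then have "X \<lesssim> f ` X \<times> (UNIV :: nat set)"
    unfolding lepoll_def by (intro exI[of _ g]) (auto simp: g_def)
  also have "\<dots> \<lesssim> f ` X \<times> f ` X"
    using inf infinite_le_lepoll by (blast intro: times_lepoll_mono lepoll_refl)
  also have "\<dots> \<approx> f ` X"
    using card_of_Times_same_infinite[OF inf] unfolding eqpoll_def card_of_ordIso .
  finally show ?thesis .
qed

lemma infinite_nat_sets: "infinite (UNIV :: nat set set)"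
  by (metis Finite_Set.finite_set infinite_UNIV_nat)

text \<open>Lower bound: send each \<open>\<phi>\<close> in \<open>H\<close> to a base member around
  0 inside its kernel. Each base member is hit finitely often, so the base is at least as large as
  \<open>H\<close>. Upper bound: a countable set has at most continuum many subsets.\<close>

lemma has_weight_weak_topology:
  assumes bdd: "bounded_group TYPE('a::ab_group_add)"
    and cnt: "countable (UNIV :: 'a set)"
    and H: "H \<subseteq> (characters :: ('a \<Rightarrow> complex) set)"
    and large: "(UNIV :: nat set set) \<lesssim> H"
  shows "has_weight (weak_topology H) (UNIV :: real set)"
proof -
  have lower: "(UNIV :: real set) \<lesssim> \<B>" if \<B>: "base_of_topology (weak_topology H) \<B>" for \<B>
  proof -
    have "\<exists>V\<in>\<B>. 0 \<in> V \<and> V \<subseteq> annihilator {\<phi>}" if "\<phi> \<in> H" for \<phi>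
    proof -
      have "annihilator {\<phi>} \<in> annihilator ` Fpow H"
        using that by (simp add: Fpow_def)
      then have "openin (weak_topology H) (annihilator {\<phi>})"
        unfolding weak_topology_def by (rule openin_linear_base[OF subgroup_base_weak[OF H]])
      moreover have "0 \<in> annihilator {\<phi>}"
        using that H character_zero by (auto simp: annihilator_def)
      ultimately show ?thesis
        using \<B> unfolding base_of_topology_def by blast
    qed
    then obtain f where f: "\<And>\<phi>. \<phi> \<in> H \<Longrightarrow> f \<phi> \<in> \<B> \<and> 0 \<in> f \<phi> \<and> f \<phi> \<subseteq> annihilator {\<phi>}"
      by metis
    have "finite {\<phi> \<in> H. f \<phi> = V}" for V
    proof (cases "\<exists>\<phi>\<in>H. f \<phi> = V")
      case True
      then have "openin (weak_topology H) V" "0 \<in> V"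
        using f \<B> unfolding base_of_topology_def by blast+
      then obtain \<Phi> where \<Phi>: "finite \<Phi>" "\<Phi> \<subseteq> H" "annihilator \<Phi> \<subseteq> V"
        unfolding openin_weak_topology[OF H] by fastforce
      have "{\<phi> \<in> H. f \<phi> = V} \<subseteq> {\<phi> \<in> characters. \<forall>x\<in>annihilator \<Phi>. \<phi> x = 1}"
      proof
        fix \<phi> assume "\<phi> \<in> {\<phi> \<in> H. f \<phi> = V}"
        then have "\<phi> \<in> H" "V \<subseteq> annihilator {\<phi>}"
          using f by blast+
        then show "\<phi> \<in> {\<phi> \<in> characters. \<forall>x\<in>annihilator \<Phi>. \<phi> x = 1}"
          using \<Phi>(3) H by (auto simp: annihilator_def)
      qed
      moreover have "\<Phi> \<subseteq> characters"
        using \<Phi>(2) H by simp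
      ultimately show ?thesis
        using finite_characters_trivial_on_annihilator[OF bdd \<Phi>(1)] by (blast intro: finite_subset)
    next
      case False
      then have "{\<phi> \<in> H. f \<phi> = V} = {}"
        by blast
      then show ?thesis
        by (simp only: finite.emptyI)
    qed
    moreover have "infinite H"
      using large infinite_nat_sets lepoll_def inj_on_finite by metis
    ultimately have "H \<lesssim> f ` H"
      by (intro lepoll_image_finite_fibres)
    also have "\<dots> \<lesssim> \<B>"
      using f by (intro subset_imp_lepoll) auto
    finally have "H \<lesssim> \<B>" .
    then show ?thesis
      using large nat_sets_eqpoll_reals by (meson eqpoll_imp_lepoll eqpoll_sym lepoll_trans)
  qed
  \<comment> \<open>The family of all open sets is itself a base of the required size.\<close>
  define \<O> where "\<O> = {V. openin (weak_topology H) V}"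
  have base: "base_of_topology (weak_topology H) \<O>"
    by (auto simp: base_of_topology_def \<O>_def)
  have "inj (\<lambda>V. to_nat_on (UNIV :: 'a set) ` V)"
    using inj_on_to_nat_on[OF cnt] by (simp add: inj_image_eq_iff inj_def)
  then have "\<O> \<lesssim> (UNIV :: nat set set)"
    unfolding lepoll_def by (meson inj_on_subset subset_UNIV)
  then have "\<O> \<lesssim> (UNIV :: real set)"
    using nat_sets_eqpoll_reals by (meson eqpoll_imp_lepoll lepoll_trans)
  then have "\<O> \<approx> (UNIV :: real set)"
    using lower[OF base] by (rule lepoll_antisym)
  then show ?thesis
    unfolding has_weight_def using base lower by blast
qed

section \<open>Biorthogonal systems\<close>

text \<open>One stage of the recursion. Adding to \<open>\<Psi>\<close> a character nontrivial at
  \<open>f\<close> for each nonzero \<open>f\<close> in the finite subgroup \<open>F\<close> makes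
  the annihilator meet \<open>F\<close> trivially. A nonzero \<open>x\<close> in the annihilator
  then lies outside \<open>F\<close> and is separated from it.\<close>

lemma biorthogonal_step:
  assumes bdd: "bounded_group TYPE('a::ab_group_add)" and inf: "infinite (UNIV :: 'a set)"
    and E: "finite (E :: 'a set)" and \<Psi>: "finite \<Psi>" "\<Psi> \<subseteq> characters"
  shows "\<exists>F \<Phi> x \<xi>. finite F \<and> E \<subseteq> F \<and> finite \<Phi> \<and> \<Psi> \<subseteq> \<Phi> \<and> \<Phi> \<subseteq> characters \<and>
    annihilator \<Phi> \<inter> F = {0} \<and> x \<in> annihilator \<Phi> \<and>
    \<xi> \<in> characters \<and> (\<forall>u\<in>F. \<xi> u = 1) \<and> \<xi> x \<noteq> 1"
proof -
  obtain F where F: "finite F" "additive_subgroup F" "E \<subseteq> F"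
    using finite_subset_finite_subgroup[OF bdd E] by blast
  have trivial: "additive_subgroup {0 :: 'a}"
    by (simp add: additive_subgroup_def)
  have "\<exists>\<phi>\<in>characters. \<phi> f \<noteq> 1" if "f \<in> F - {0}" for f
    using character_separates_subgroup[OF bdd trivial, of f] that by blast
  then obtain c where c: "\<And>f. f \<in> F - {0} \<Longrightarrow> c f \<in> characters \<and> c f f \<noteq> 1"
    by metis
  define \<Phi> where "\<Phi> = \<Psi> \<union> c ` (F - {0})"
  have \<Phi>: "finite \<Phi>" "\<Psi> \<subseteq> \<Phi>" "\<Phi> \<subseteq> characters"
    using F(1) \<Psi> c by (auto simp: \<Phi>_def)
  have zero: "0 \<in> annihilator \<Phi>"
    using additive_subgroupD(1)[OF additive_subgroup_annihilator[OF \<Phi>(3)]] .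
  have meet: "annihilator \<Phi> \<inter> F = {0}"
    using zero additive_subgroupD(1)[OF F(2)] c by (auto simp: annihilator_def \<Phi>_def)
  \<comment> \<open>A trivial annihilator of finite index would make the group finite.\<close>
  have "annihilator \<Phi> \<noteq> {0}"
  proof
    assume "annihilator \<Phi> = {0}"
    then obtain D :: "'a set" where "finite D" "\<forall>x. x \<in> D"
      using finite_transversal_annihilator[OF bdd \<Phi>(1,3)] by auto
    then show False
      using inf by (metis UNIV_eq_I)
  qed
  then obtain x where x: "x \<in> annihilator \<Phi>" "x \<noteq> 0"
    using zero by blast
  then have "x \<notin> F"
    using meet by blast
  then obtain \<xi> where "\<xi> \<in> characters" "\<And>u. u \<in> F \<Longrightarrow> \<xi> u = 1" "\<xi> x \<noteq> 1"
    using character_separates_subgroup[OF bdd F(2)] by metis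
  then show ?thesis
    using F \<Phi> meet x(1) by blast
qed

text \<open>What survives of the construction. The finite subgroups have left their trace in
  \<open>separating\<close>, \<open>finite_support\<close> and one half of
  \<open>biorthogonal\<close>.\<close>

locale biorthogonal_system =
  fixes \<Phi> :: "nat \<Rightarrow> ('a::ab_group_add \<Rightarrow> complex) set"
    and x :: "nat \<Rightarrow> 'a" and \<xi> :: "nat \<Rightarrow> 'a \<Rightarrow> complex"
  assumes mono_\<Phi>: "mono \<Phi>"
    and \<Phi>_characters: "\<Phi> n \<subseteq> characters"
    and \<xi>_character: "\<xi> n \<in> characters"
    and x_annihilator: "x n \<in> annihilator (\<Phi> n)"
    and separating: "(\<Inter>n. annihilator (\<Phi> n)) = {0}"
    and biorthogonal: "\<xi> n (x k) = 1 \<longleftrightarrow> n \<noteq> k"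
    and finite_support: "finite {n. \<xi> n g \<noteq> 1}"

text \<open>Dependent choice over the stages. For \<open>n < k\<close>, \<open>\<xi> n\<close>
  belongs to \<open>\<Phi> k\<close>, which \<open>x k\<close> annihilates; for
  \<open>n > k\<close>, \<open>x k\<close> lies in \<open>F n\<close>, where \<open>\<xi> n\<close>
  is trivial. Since the \<open>F n\<close> exhaust the group, each point is eventually killed by all
  \<open>\<xi> n\<close>.\<close>

lemma biorthogonal_system_exists:
  assumes bdd: "bounded_group TYPE('a::ab_group_add)"
    and cnt: "countable (UNIV :: 'a set)" and inf: "infinite (UNIV :: 'a set)"
  shows "\<exists>\<Phi> x (\<xi> :: nat \<Rightarrow> 'a \<Rightarrow> complex). biorthogonal_system \<Phi> x \<xi>"
proof -
  define P where "P = (\<lambda>(n::nat) (F :: 'a set, \<Phi>, x, \<xi>). finite F \<and> finite \<Phi> \<and> \<Phi> \<subseteq> characters \<and>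
    annihilator \<Phi> \<inter> F = {0} \<and> x \<in> annihilator \<Phi> \<and>
    \<xi> \<in> characters \<and> (\<forall>u\<in>F. \<xi> u = 1) \<and> \<xi> x \<noteq> 1)"
  \<comment> \<open>Feeding in the \<open>n\<close>-th element of an enumeration of the group makes
    the union of the subsets \<open>F n\<close> everything.\<close>
  define Q where "Q = (\<lambda>n (F :: 'a set, \<Phi> :: ('a \<Rightarrow> complex) set, x, \<xi>) (F', \<Phi>', x' :: 'a, \<xi>' :: 'a \<Rightarrow> complex).
    F \<subseteq> F' \<and> x \<in> F' \<and> from_nat_into UNIV n \<in> F' \<and> \<Phi> \<subseteq> \<Phi>' \<and> \<xi> \<in> \<Phi>')"
  have "\<exists>s. P 0 s"
    using biorthogonal_step[OF bdd inf, of "{}" "{}"] by (auto simp: P_def)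
  moreover have "\<exists>s'. P (Suc n) s' \<and> Q n s s'" if "P n s" for n s
  proof -
    obtain F \<Phi> x \<xi> where s: "s = (F, \<Phi>, x, \<xi>)"
      using prod_cases4 by blast
    have "finite (insert x (insert (from_nat_into UNIV n) F))" "finite (insert \<xi> \<Phi>)"
      "insert \<xi> \<Phi> \<subseteq> characters"
      using that unfolding s by (auto simp: P_def)
    from biorthogonal_step[OF bdd inf this] obtain F' \<Phi>' x' \<xi>' where
      "P (Suc n) (F', \<Phi>', x', \<xi>')" "Q n s (F', \<Phi>', x', \<xi>')"
      unfolding s by (auto simp: P_def Q_def)
    then show ?thesis
      by blast
  qed
  ultimately obtain s where s: "\<And>n. P n (s n)" "\<And>n. Q n (s n) (s (Suc n))"
    using dependent_nat_choice[of P Q] by blast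
  define F \<Phi> x \<xi> where defs: "F = (\<lambda>n. fst (s n))" "\<Phi> = (\<lambda>n. fst (snd (s n)))"
    "x = (\<lambda>n. fst (snd (snd (s n))))" "\<xi> = (\<lambda>n. snd (snd (snd (s n))))"
  have s_eq: "s n = (F n, \<Phi> n, x n, \<xi> n)" for n
    by (simp add: defs)
  have P: "\<Phi> n \<subseteq> characters" "annihilator (\<Phi> n) \<inter> F n = {0}" "x n \<in> annihilator (\<Phi> n)"
    "\<xi> n \<in> characters" "\<And>u. u \<in> F n \<Longrightarrow> \<xi> n u = 1" "\<xi> n (x n) \<noteq> 1" for n
    using s(1)[of n] unfolding s_eq by (simp_all add: P_def)
  have Q: "F n \<subseteq> F (Suc n)" "x n \<in> F (Suc n)" "from_nat_into UNIV n \<in> F (Suc n)"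
    "\<Phi> n \<subseteq> \<Phi> (Suc n)" "\<xi> n \<in> \<Phi> (Suc n)" for n
    using s(2)[of n] unfolding s_eq by (simp_all add: Q_def)
  have mono_F: "F i \<subseteq> F j" and mono_\<Phi>: "\<Phi> i \<subseteq> \<Phi> j" if "i \<le> j" for i j
    using lift_Suc_mono_le[of F] lift_Suc_mono_le[of \<Phi>] Q that by auto
  have exhaust: "\<exists>n. g \<in> F n" for g
  proof -
    obtain n where "g = from_nat_into UNIV n"
      using range_from_nat_into[OF _ cnt] by blast
    then show ?thesis
      using Q(3) by blast
  qed
  have "biorthogonal_system \<Phi> x \<xi>"
  proof
    show "mono \<Phi>"
      using mono_\<Phi> by (rule monoI)
    have "0 \<in> annihilator (\<Phi> n)" for n
      using P(2)[of n] by auto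
    moreover have "g = 0" if g: "\<And>n. g \<in> annihilator (\<Phi> n)" for g
    proof -
      obtain n where "g \<in> F n"
        using exhaust by blast
      then show ?thesis
        using P(2)[of n] g[of n] by auto
    qed
    ultimately show "(\<Inter>n. annihilator (\<Phi> n)) = {0}"
      by auto
    show "\<xi> n (x k) = 1 \<longleftrightarrow> n \<noteq> k" for n k
    proof (cases n k rule: linorder_cases)
      case less
      then have "\<xi> n \<in> \<Phi> k"
        using Q(5)[of n] mono_\<Phi>[of "Suc n" k] by auto
      then show ?thesis
        using P(3)[of k] less by (simp add: annihilator_def)
    next
      case equal
      then show ?thesis
        using P(6) by simp
    next
      case greater
      then have "x k \<in> F n"
        using Q(2)[of k] mono_F[of "Suc k" n] by auto
      then show ?thesis
        using P(5) greater by simp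
    qed
    show "finite {n. \<xi> n g \<noteq> 1}" for g
    proof -
      obtain k where "g \<in> F k"
        using exhaust by blast
      then have "\<xi> n g = 1" if "k \<le> n" for n
        using mono_F[OF that] P(5) by blast
      then have "{n. \<xi> n g \<noteq> 1} \<subseteq> {..<k}"
        by (auto simp: not_less[symmetric])
      then show ?thesis
        by (rule finite_subset) simp
    qed
  qed (use P in auto)
  then show ?thesis
    by blast
qed

section \<open>The fine and the precompact topology attached to an index set\<close>

context biorthogonal_system
begin

text \<open>The possibly infinite product of the \<open>\<xi> n\<close> over \<open>B\<close>;
  dropping the factors equal to 1 at \<open>g\<close> leaves a finite product by
  \<open>finite_support\<close>.\<close>

definition product_character :: "nat set \<Rightarrow> 'a \<Rightarrow> complex" where
  "product_character B g = (\<Prod>n\<in>{n \<in> B. \<xi> n g \<noteq> 1}. \<xi> n g)"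

lemma product_character_eq:
  assumes "finite T" "{n. \<xi> n g \<noteq> 1} \<subseteq> T"
  shows "product_character B g = (\<Prod>n\<in>B \<inter> T. \<xi> n g)"
  unfolding product_character_def using assms by (intro prod.mono_neutral_left) auto

lemma product_character: "product_character B \<in> characters"
proof -
  have "product_character B (g + h) = product_character B g * product_character B h" for g h
  proof -
    \<comment> \<open>A common finite index set for the three points, so that the products can be
      compared factor by factor.\<close>
    define T where "T = {n. \<xi> n g \<noteq> 1} \<union> {n. \<xi> n h \<noteq> 1} \<union> {n. \<xi> n (g + h) \<noteq> 1}"
    have "finite T"
      unfolding T_def using finite_support by blast
    then have "product_character B a = (\<Prod>n\<in>B \<inter> T. \<xi> n a)" if "a \<in> {g, h, g + h}" for a
      using that by (intro product_character_eq) (auto simp: T_def)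
    then show ?thesis
      by (simp add: character_add[OF \<xi>_character] prod.distrib)
  qed
  moreover have "norm (product_character B g) = 1" for g
    unfolding product_character_def prod_norm[symmetric]
    by (simp add: character_norm[OF \<xi>_character])
  ultimately show ?thesis
    by (simp add: characters_def circle_def)
qed

text \<open>By biorthogonality at most the factor with index \<open>n\<close> survives. The values
  at the points \<open>x n\<close> therefore recover \<open>B\<close>.\<close>

lemma product_character_x: "product_character B (x n) = (if n \<in> B then \<xi> n (x n) else 1)"
proof -
  have "{k \<in> B. \<xi> k (x n) \<noteq> 1} = (if n \<in> B then {n} else {})"
    by (auto simp: biorthogonal)
  then show ?thesis
    by (simp add: product_character_def)
qed

lemma product_character_x_eq_1: "product_character B (x n) = 1 \<longleftrightarrow> n \<notin> B"
  by (simp add: product_character_x biorthogonal)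

lemma inj_product_character: "inj product_character"
  by (rule injI) (metis product_character_x_eq_1 subsetI subset_antisym)

lemma inj_\<xi>: "inj \<xi>"
  by (rule injI) (metis biorthogonal)

text \<open>\<open>A\<close> stays whole while \<open>k\<close> grows. For infinite \<open>A\<close>
  these subgroups are annihilated by infinitely many characters and so have infinite index.\<close>

definition neighbourhoods :: "nat set \<Rightarrow> 'a set set" where
  "neighbourhoods A = range (\<lambda>k. annihilator (\<Phi> k \<union> \<xi> ` A))"

definition fine_topology :: "nat set \<Rightarrow> 'a topology" where
  "fine_topology A = linear_topology (neighbourhoods A)"

definition coarse_topology :: "nat set \<Rightarrow> 'a topology" where
  "coarse_topology A = weak_topology (dual_group (fine_topology A))"

lemma subgroup_base_neighbourhoods: "subgroup_base (neighbourhoods A)"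
  unfolding subgroup_base_def neighbourhoods_def
proof (intro conjI ballI)
  show "additive_subgroup U" if "U \<in> range (\<lambda>k. annihilator (\<Phi> k \<union> \<xi> ` A))" for U
  proof -
    have "additive_subgroup (annihilator (\<Phi> k \<union> \<xi> ` A))" for k
      using \<Phi>_characters \<xi>_character by (intro additive_subgroup_annihilator) auto
    then show ?thesis
      using that by blast
  qed
  fix U V
  assume "U \<in> range (\<lambda>k. annihilator (\<Phi> k \<union> \<xi> ` A))" "V \<in> range (\<lambda>k. annihilator (\<Phi> k \<union> \<xi> ` A))"
  then obtain i j where "U = annihilator (\<Phi> i \<union> \<xi> ` A)" "V = annihilator (\<Phi> j \<union> \<xi> ` A)"
    by blast
  moreover have "\<Phi> i \<subseteq> \<Phi> (max i j)" "\<Phi> j \<subseteq> \<Phi> (max i j)"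
    using mono_\<Phi> by (auto simp: mono_def)
  ultimately have "annihilator (\<Phi> (max i j) \<union> \<xi> ` A) \<subseteq> U \<inter> V"
    by (auto simp: annihilator_def)
  then show "\<exists>W\<in>range (\<lambda>k. annihilator (\<Phi> k \<union> \<xi> ` A)). W \<subseteq> U \<inter> V"
    by blast
qed auto

lemma Inter_neighbourhoods: "\<Inter>(neighbourhoods A) = {0}"
proof
  have "\<Inter>(neighbourhoods A) \<subseteq> (\<Inter>n. annihilator (\<Phi> n))"
    by (auto simp: neighbourhoods_def annihilator_def)
  then show "\<Inter>(neighbourhoods A) \<subseteq> {0}"
    by (simp add: separating)
  show "{0} \<subseteq> \<Inter>(neighbourhoods A)"
    using additive_subgroupD(1)[OF subgroup_baseD(2)[OF subgroup_base_neighbourhoods]] by blast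
qed

context
  assumes bdd: "bounded_group TYPE('a)"
begin

lemma dual_fine_topology:
  "dual_group (fine_topology A) =
     {\<phi> \<in> characters. \<exists>k. \<forall>u\<in>annihilator (\<Phi> k \<union> \<xi> ` A). \<phi> u = 1}"
  unfolding fine_topology_def dual_linear_topology[OF subgroup_base_neighbourhoods bdd]
  by (simp add: neighbourhoods_def)

lemma dual_fine_topology_characters: "dual_group (fine_topology A) \<subseteq> characters"
  by (auto simp: dual_fine_topology)

lemma dual_coarse_topology: "dual_group (coarse_topology A) = dual_group (fine_topology A)"
  unfolding coarse_topology_def fine_topology_def
  by (rule dual_weak_topology[OF bdd subgroup_base_neighbourhoods])

lemma product_character_in_dual:
  assumes "B \<subseteq> A" shows "product_character B \<in> dual_group (fine_topology A)"
proof -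
  have "product_character B u = 1" if "u \<in> annihilator (\<Phi> 0 \<union> \<xi> ` A)" for u
  proof -
    have "{n \<in> B. \<xi> n u \<noteq> 1} = {}"
      using that assms by (auto simp: annihilator_def)
    then show ?thesis
      by (simp only: product_character_def prod.empty)
  qed
  then show ?thesis
    using product_character by (auto simp: dual_fine_topology)
qed

text \<open>The dual contains every \<open>\<Phi> k\<close>, and the annihilators of these meet in
  0.\<close>

lemma precompact_coarse_topology: "precompact (coarse_topology A)"
  unfolding coarse_topology_def
proof (rule precompact_weak_topology[OF bdd dual_fine_topology_characters])
  have "\<Phi> k \<subseteq> dual_group (fine_topology A)" for k
    using \<Phi>_characters by (auto simp: dual_fine_topology annihilator_def)
  then have "annihilator (dual_group (fine_topology A)) \<subseteq> (\<Inter>n. annihilator (\<Phi> n))"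
    by (auto simp: annihilator_def)
  then have "annihilator (dual_group (fine_topology A)) \<subseteq> {0}"
    unfolding separating .
  then show "annihilator (dual_group (fine_topology A)) = {0}"
    using additive_subgroupD(1)[OF additive_subgroup_annihilator[OF dual_fine_topology_characters]]
    by blast
qed

lemma has_weight_coarse_topology:
  assumes "countable (UNIV :: 'a set)" "infinite A"
  shows "has_weight (coarse_topology A) (UNIV :: real set)"
  unfolding coarse_topology_def
proof (rule has_weight_weak_topology[OF bdd assms(1) dual_fine_topology_characters])
  \<comment> \<open>A copy of the natural numbers inside \<open>A\<close>: products over its subsets
    are distinct members of the dual.\<close>
  obtain e :: "nat \<Rightarrow> nat" where e: "inj e" "range e \<subseteq> A"
    using infinite_countable_subset[OF assms(2)] by blast
  have "inj (\<lambda>Y. product_character (e ` Y))"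
  proof (rule injI)
    fix Y Z assume "product_character (e ` Y) = product_character (e ` Z)"
    then have "e ` Y = e ` Z"
      by (rule injD[OF inj_product_character])
    then show "Y = Z"
      by (simp add: inj_image_eq_iff[OF e(1)])
  qed
  moreover have "range (\<lambda>Y. product_character (e ` Y)) \<subseteq> dual_group (fine_topology A)"
    using e(2) by (auto intro!: product_character_in_dual)
  ultimately show "(UNIV :: nat set set) \<lesssim> dual_group (fine_topology A)"
    unfolding lepoll_def by blast
qed

text \<open>The fine topology is compatible and locally quasi-convex. Were it coarser, the basic
  subgroup \<open>U\<close> would contain the annihilator of a finite set of characters, and the
  infinitely many \<open>\<xi> n\<close> with \<open>n\<close> in \<open>A\<close> would all be
  trivial there.\<close>

lemma not_mackey_coarse_topology:
  assumes "infinite A"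
  shows "\<not> mackey (coarse_topology A)"
proof
  assume "mackey (coarse_topology A)"
  moreover have "locally_quasi_convex (fine_topology A)"
    unfolding fine_topology_def
    by (rule locally_quasi_convex_linear[OF subgroup_base_neighbourhoods bdd Inter_neighbourhoods])
  moreover have "compatible (fine_topology A) (coarse_topology A)"
    by (simp add: compatible_def dual_coarse_topology)
  ultimately have coarser: "coarser (fine_topology A) (coarse_topology A)"
    by (simp add: mackey_def)
  define U where "U = annihilator (\<Phi> 0 \<union> \<xi> ` A)"
  have U: "U \<in> neighbourhoods A"
    by (simp add: U_def neighbourhoods_def)
  then have "openin (coarse_topology A) U"
    using coarser openin_linear_base[OF subgroup_base_neighbourhoods U]
    by (simp add: coarser_def fine_topology_def)
  moreover have "0 \<in> U"
    using additive_subgroupD(1)[OF subgroup_baseD(2)[OF subgroup_base_neighbourhoods U]] .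
  ultimately obtain \<Psi> where \<Psi>: "finite \<Psi>" "\<Psi> \<subseteq> dual_group (fine_topology A)" "annihilator \<Psi> \<subseteq> U"
    unfolding coarse_topology_def openin_weak_topology[OF dual_fine_topology_characters] by fastforce
  have "\<Psi> \<subseteq> characters"
    using \<Psi>(2) dual_fine_topology_characters by (rule subset_trans)
  then have "finite {\<phi> \<in> characters. \<forall>x\<in>annihilator \<Psi>. \<phi> x = 1}"
    by (rule finite_characters_trivial_on_annihilator[OF bdd \<Psi>(1)])
  moreover have "\<xi> ` A \<subseteq> {\<phi> \<in> characters. \<forall>x\<in>annihilator \<Psi>. \<phi> x = 1}"
    using \<Psi>(3) \<xi>_character by (auto simp: U_def annihilator_def)
  ultimately have "finite (\<xi> ` A)"
    by (rule rev_finite_subset)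
  then show False
    using assms inj_\<xi> by (meson finite_imageD inj_on_subset subset_UNIV)
qed

text \<open>Equal topologies have equal duals, so the product over \<open>A\<close> is trivial on
  some basic subgroup for \<open>B\<close>, with index \<open>k\<close>. For
  \<open>n \<ge> k\<close> in \<open>A - B\<close> that subgroup contains \<open>x n\<close>, where
  the product is not 1.\<close>

lemma coarse_topology_eq_imp_finite_diff:
  assumes "coarse_topology A = coarse_topology B"
  shows "finite (A - B)"
proof -
  have "product_character A \<in> dual_group (fine_topology B)"
    using product_character_in_dual[of A A] dual_coarse_topology assms by (metis order_refl)
  then obtain k where k: "\<And>u. u \<in> annihilator (\<Phi> k \<union> \<xi> ` B) \<Longrightarrow> product_character A u = 1"
    by (auto simp: dual_fine_topology)
  have "n < k" if n: "n \<in> A - B" for n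
  proof (rule ccontr)
    assume "\<not> n < k"
    then have "\<Phi> k \<subseteq> \<Phi> n"
      using mono_\<Phi> by (auto simp: mono_def)
    then have "x n \<in> annihilator (\<Phi> k \<union> \<xi> ` B)"
      using x_annihilator[of n] n biorthogonal by (auto simp: annihilator_def)
    then show False
      using k n product_character_x_eq_1 by blast
  qed
  then have "A - B \<subseteq> {..<k}"
    by blast
  then show ?thesis
    by (rule finite_subset) simp
qed

end

end

section \<open>Continuum many index sets, distinct modulo finite sets\<close>

lemma infinite_set_family_mod_finite:
  obtains A :: "nat set \<Rightarrow> nat set"
  where "\<And>X. infinite (A X)" "\<And>X Y. finite (A X - A Y) \<Longrightarrow> X \<subseteq> Y"
proof
  \<comment> \<open>A union of columns of the pairing function. Column 0 is always present, so that
    even the empty \<open>X\<close> yields an infinite set; the shift by \<open>Suc\<close> keeps it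
    apart from the columns encoding \<open>X\<close>, each of which is infinite.\<close>
  define A where "A X = {prod_encode (i, j) | i j. i \<in> insert 0 (Suc ` X)}" for X :: "nat set"
  have column: "infinite (range (\<lambda>j. prod_encode (i, j)))" for i
    by (intro range_inj_infinite injI) simp
  show "infinite (A X)" for X
    by (rule infinite_super[OF _ column[of 0]]) (auto simp: A_def)
  show "X \<subseteq> Y" if "finite (A X - A Y)" for X Y
  proof
    fix i assume "i \<in> X"
    show "i \<in> Y"
    proof (rule ccontr)
      assume "i \<notin> Y"
      with \<open>i \<in> X\<close> have "range (\<lambda>j. prod_encode (Suc i, j)) \<subseteq> A X - A Y"
        by (auto simp: A_def)
      then show False
        using column that finite_subset by blast
    qed
  qed
qed

theorem corollaryB:
  assumes "bounded_group TYPE('a::ab_group_add)"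
    and "countable (UNIV :: 'a set)"
    and "infinite (UNIV :: 'a set)"
  shows "\<exists>S :: 'a topology set.
           S \<approx> (UNIV :: real set) \<and>
           (\<forall>\<tau>\<in>S. precompact \<tau> \<and> has_weight \<tau> (UNIV :: real set) \<and> \<not> mackey \<tau>)"
proof -
  obtain \<Phi> x and \<xi> :: "nat \<Rightarrow> 'a \<Rightarrow> complex" where "biorthogonal_system \<Phi> x \<xi>"
    using biorthogonal_system_exists[OF assms] by blast
  then interpret biorthogonal_system \<Phi> x \<xi> .
  obtain A :: "nat set \<Rightarrow> nat set" where A: "\<And>X. infinite (A X)"
    "\<And>X Y. finite (A X - A Y) \<Longrightarrow> X \<subseteq> Y"
    using infinite_set_family_mod_finite by blast
  define \<tau> where "\<tau> X = coarse_topology (A X)" for X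
  \<comment> \<open>Equality of the topologies makes both differences of index sets finite, which
    gives both inclusions.\<close>
  have "inj \<tau>"
  proof (rule injI)
    fix X Y assume "\<tau> X = \<tau> Y"
    then show "X = Y"
      using A(2) coarse_topology_eq_imp_finite_diff[OF assms(1)] unfolding \<tau>_def
      by (metis subset_antisym)
  qed
  then have "range \<tau> \<approx> (UNIV :: nat set set)"
    by (rule inj_on_image_eqpoll_self)
  then have "range \<tau> \<approx> (UNIV :: real set)"
    using nat_sets_eqpoll_reals by (rule eqpoll_trans)
  moreover have "precompact \<sigma> \<and> has_weight \<sigma> (UNIV :: real set) \<and> \<not> mackey \<sigma>"
    if "\<sigma> \<in> range \<tau>" for \<sigma>
    using that A(1) precompact_coarse_topology[OF assms(1)]
      has_weight_coarse_topology[OF assms(1,2)] not_mackey_coarse_topology[OF assms(1)]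
    by (auto simp: \<tau>_def)
  ultimately show ?thesis
    by blast
qed

end
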